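(* Let $P,Q:\mathbb{Z}\to\mathbb{Z}$ be two functions, and assume that $P$ or $Q$ satisfies Condition $(\star\star)$ with constants $\delta>0$ and $\delta'>0$. Then for any $\epsilon\in\left(\frac{1}{2\delta+1},1\right)$ there exists a constant $C_{\delta,\delta'}$, depending only on $\delta$ and $\delta'$, such that the operator $$B_{P,Q}^{\mathrm{dis}}(f,g)(n)=\sum_{m\in\mathbb{Z}\setminus\{0\}} f(n-P(m))\,g(n-Q(m))\,\frac{1}{m},\qquad n\in\mathbb{Z},$$ satisfies $$\|B_{P,Q}^{\mathrm{dis}}(f,g)\|_{l^{1+\epsilon}}\le C_{\delta,\delta'}\,\|f\|_{l^2}\,\|g\|_{l^2}\qquad\text{for any } f,g\in l^2.$$
   Context: Here $l^p=l^p(\mathbb{Z})$ denotes the usual space of complex-valued functions on $\mathbb{Z}$ with its usual norm. For a finite set $E$, $|E|$ denotes its cardinality. For a function $R:\mathbb{Z}\to\mathbb{Z}$ and $M,N>0$, let $$S_{M,N}^R:=\left\{(m,n)\in\mathbb{Z}^2:\ R(m)=R(n),\ \tfrac12 N\le |n|\le 2N,\ \tfrac12 M\le |m|\le 2M\right\}.$$ The function $R$ satisfies Condition $(\star\star)$ with constants $\delta>0$ and $\delta'>0$ if, for all real $M,N\ge 2$, $$|S_{M,N}^R|\le \frac{\delta' MN}{(\log M\,\log N)^{1+\delta}}.$$ When only one of $P,Q$ is assumed to satisfy Condition $(\star\star)$, the other is an arbitrary function $\mathbb{Z}\to\mathbb{Z}$.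
   Formalization: The constant is allowed to depend on ε as well as on δ and δ'; a constant depending only on δ and δ', uniform over all ε in the open interval, would force the endpoint ε = 1/(2δ+1), where the estimate fails in general. *)

theory Defs
  imports "HOL-Analysis.Analysis"
begin

text \<open>The spaces \<open>l\<^sup>p(\<int>)\<close> for real \<open>p > 0\<close>. The value \<open>lp_norm p f\<close> is meaningful only for
  \<open>f \<in> lp_space p\<close>, since \<open>infsum\<close> returns \<open>0\<close> on families that are not summable.\<close>

definition lp_space :: "real \<Rightarrow> (int \<Rightarrow> complex) set" where
  "lp_space p = {f. (\<lambda>n. norm (f n) powr p) summable_on UNIV}"

definition lp_norm :: "real \<Rightarrow> (int \<Rightarrow> complex) \<Rightarrow> real" where
  "lp_norm p f = (\<Sum>\<^sub>\<infinity>n. norm (f n) powr p) powr (1 / p)"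

definition coincidence_set :: "(int \<Rightarrow> int) \<Rightarrow> real \<Rightarrow> real \<Rightarrow> (int \<times> int) set" where
  "coincidence_set R M N = {(m, n). R m = R n \<and>
     N / 2 \<le> real_of_int \<bar>n\<bar> \<and> real_of_int \<bar>n\<bar> \<le> 2 * N \<and>
     M / 2 \<le> real_of_int \<bar>m\<bar> \<and> real_of_int \<bar>m\<bar> \<le> 2 * M}"

text \<open>Finiteness matters because \<open>card\<close> of an infinite set is \<open>0\<close>.\<close>

lemma finite_coincidence_set: "finite (coincidence_set R M N)"
proof (rule finite_subset)
  show "coincidence_set R M N \<subseteq>
      {- \<lfloor>2 * M\<rfloor>..\<lfloor>2 * M\<rfloor>} \<times> {- \<lfloor>2 * N\<rfloor>..\<lfloor>2 * N\<rfloor>}"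
    unfolding coincidence_set_def by (auto simp: minus_le_iff le_floor_iff abs_le_iff)
qed simp

definition condition_star_star :: "real \<Rightarrow> real \<Rightarrow> (int \<Rightarrow> int) \<Rightarrow> bool" where
  "condition_star_star \<delta> \<delta>' R \<longleftrightarrow> (\<forall>M N. M \<ge> 2 \<longrightarrow> N \<ge> 2 \<longrightarrow>
     real (card (coincidence_set R M N)) \<le> \<delta>' * M * N / (ln M * ln N) powr (1 + \<delta>))"

definition B_dis_term ::
  "(int \<Rightarrow> int) \<Rightarrow> (int \<Rightarrow> int) \<Rightarrow> (int \<Rightarrow> complex) \<Rightarrow> (int \<Rightarrow> complex) \<Rightarrow> int \<Rightarrow> int \<Rightarrow> complex" where
  "B_dis_term P Q f g n m = f (n - P m) * g (n - Q m) * (1 / of_int m)"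

definition B_dis ::
  "(int \<Rightarrow> int) \<Rightarrow> (int \<Rightarrow> int) \<Rightarrow> (int \<Rightarrow> complex) \<Rightarrow> (int \<Rightarrow> complex) \<Rightarrow> int \<Rightarrow> complex" where
  "B_dis P Q f g n = (\<Sum>\<^sub>\<infinity>m\<in>UNIV - {0}. B_dis_term P Q f g n m)"

end

theory Submission
  imports Defs
begin

text \<open>Split the sum over \<open>m\<close> into dyadic blocks \<open>2 ^ k \<le> \<bar>m\<bar> < 2 ^ (k + 1)\<close>. The \<open>l\<^sup>1\<close> norm of each
  block is bounded by a multiple of \<open>\<parallel>f\<parallel>\<^sub>2 \<parallel>g\<parallel>\<^sub>2\<close>. For its \<open>l\<^sup>2\<close> norm, apply Cauchy-Schwarz in \<open>m\<close>
  with the weight \<open>r(m) = #{m'. P m' = P m}\<close>, so that the number of coincidences enters only through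
  its square root; this gives the decay \<open>(k + 1) powr - (1 + \<delta>)\<close>. Interpolating between the two,
  the \<open>l\<^bsup>1+\<epsilon>\<^esup>\<close> norm of the block decays like \<open>(k + 1)\<close> to the power
  \<open>- 2 \<epsilon> (1 + \<delta>) / (1 + \<epsilon>)\<close>, which is summable exactly when \<open>\<epsilon> > 1 / (2 \<delta> + 1)\<close>.\<close>

section \<open>Convexity and interpolation inequalities for finite sums\<close>

text \<open>Jensen's inequality for the p-th power with normalised weights \<open>w k / W\<close>,
  applied to \<open>W * x k / w k\<close>. It serves in place of Minkowski's inequality when the
  dyadic blocks are added up: summable weights are paid for by the factors
  \<open>w k powr (1 - p)\<close>.\<close>

lemma powr_sum_le_weighted:
  fixes w x :: "'a \<Rightarrow> real"
  assumes fin: "finite S" and p: "p \<ge> 1"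
    and w: "\<And>k. k \<in> S \<Longrightarrow> w k > 0" and x: "\<And>k. k \<in> S \<Longrightarrow> x k \<ge> 0"
  shows "(\<Sum>k\<in>S. x k) powr p \<le> (\<Sum>k\<in>S. w k) powr (p - 1) * (\<Sum>k\<in>S. w k powr (1 - p) * x k powr p)"
proof -
  \<comment> \<open>Jensen is applied to the positive entries only; returning from \<open>T\<close>
    to \<open>S\<close> keeps the left side and can only enlarge the right side.\<close>
  define T where "T = {k \<in> S. x k > 0}"
  have T: "finite T" "T \<subseteq> S" using fin by (auto simp: T_def)
  have eq: "(\<Sum>k\<in>S. x k) = (\<Sum>k\<in>T. x k)"
    by (rule sum.mono_neutral_right) (use fin x in \<open>auto simp: T_def not_less intro: antisym\<close>)
  show ?thesis
  proof (cases "T = {}")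
    case True
    then show ?thesis
      by (auto simp: eq intro!: mult_nonneg_nonneg sum_nonneg)
  next
    case False
    define W where "W = (\<Sum>k\<in>T. w k)"
    have W0: "W > 0" unfolding W_def using False T w by (intro sum_pos) auto
    have W1: "W \<le> (\<Sum>k\<in>S. w k)"
      unfolding W_def using fin T w by (intro sum_mono2) (auto intro: less_imp_le)
    have wT: "w k > 0" "x k > 0" if "k \<in> T" for k using that w by (auto simp: T_def)
    have "(\<Sum>k\<in>T. (w k / W) *\<^sub>R (W * x k / w k)) powr p
        \<le> (\<Sum>k\<in>T. (w k / W) * (W * x k / w k) powr p)"
      by (rule convex_on_sum[OF T(1) False powr_convex[OF p]])
        (use W0 wT in \<open>auto simp: W_def sum_divide_distrib[symmetric] intro: less_imp_le\<close>)
    also have "(\<Sum>k\<in>T. (w k / W) *\<^sub>R (W * x k / w k)) = (\<Sum>k\<in>T. x k)"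
      using W0 wT by (intro sum.cong) (auto simp: less_imp_neq[symmetric])
    also have "(\<Sum>k\<in>T. (w k / W) * (W * x k / w k) powr p)
        = (\<Sum>k\<in>T. W powr (p - 1) * (w k powr (1 - p) * x k powr p))"
    proof (rule sum.cong)
      fix k assume k: "k \<in> T"
      show "(w k / W) * (W * x k / w k) powr p = W powr (p - 1) * (w k powr (1 - p) * x k powr p)"
        using W0 wT[OF k] by (simp add: powr_divide powr_mult powr_diff)
    qed simp
    also have "\<dots> = W powr (p - 1) * (\<Sum>k\<in>T. w k powr (1 - p) * x k powr p)"
      by (simp add: sum_distrib_left)
    also have "\<dots> \<le> (\<Sum>k\<in>S. w k) powr (p - 1) * (\<Sum>k\<in>S. w k powr (1 - p) * x k powr p)"
      using W0 W1 p fin T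
      by (intro mult_mono powr_mono2 sum_mono2) (auto intro!: sum_nonneg)
    finally show ?thesis by (simp add: eq)
  qed
qed

text \<open>Truncation at height t: below it \<open>x powr \<epsilon>\<close> is at most
  \<open>t powr \<epsilon>\<close>, and above it the negative power
  \<open>x powr (\<epsilon> - 1)\<close> is at most \<open>t powr (\<epsilon> - 1)\<close>.\<close>

lemma powr_between_le:
  fixes x t \<epsilon> :: real
  assumes "0 < \<epsilon>" "\<epsilon> < 1" "0 \<le> x" "0 < t"
  shows "x powr (1 + \<epsilon>) \<le> t powr \<epsilon> * x + t powr (\<epsilon> - 1) * x\<^sup>2"
proof (cases "x = 0")
  case False
  then have x: "x > 0" using assms by simp
  show ?thesis
  proof (cases "x \<le> t")
    case True
    have "x powr (1 + \<epsilon>) = x powr \<epsilon> * x" using x by (simp add: powr_add)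
    also have "\<dots> \<le> t powr \<epsilon> * x" using True x assms by (intro mult_right_mono powr_mono2) auto
    finally show ?thesis by (smt (verit) mult_nonneg_nonneg powr_ge_zero zero_le_power2)
  next
    case False
    have "x powr (1 + \<epsilon>) = x powr ((\<epsilon> - 1) + 2)" by (simp add: add.commute)
    also have "\<dots> = x powr (\<epsilon> - 1) * x\<^sup>2" using x by (subst powr_add) simp
    also have "\<dots> \<le> t powr (\<epsilon> - 1) * x\<^sup>2"
      using False x assms by (intro mult_right_mono powr_mono2') auto
    finally show ?thesis using assms by (smt (verit) mult_nonneg_nonneg powr_ge_zero)
  qed
qed (use assms in simp)

text \<open>Only the l^2 bound carries the gain \<tau>; interpolation with the l^1 bound retains its
  power \<epsilon>.\<close>

lemma sum_powr_interpolation: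
  fixes h :: "'a \<Rightarrow> real"
  assumes fin: "finite N" and h: "\<And>n. n \<in> N \<Longrightarrow> h n \<ge> 0"
    and \<epsilon>: "0 < \<epsilon>" "\<epsilon> < 1" and \<tau>: "\<tau> > 0" and D: "D \<ge> 0"
    and l1: "(\<Sum>n\<in>N. h n) \<le> A * D" and l2: "(\<Sum>n\<in>N. (h n)\<^sup>2) \<le> c * \<tau> * D\<^sup>2"
  shows "(\<Sum>n\<in>N. h n powr (1 + \<epsilon>)) \<le> (A + c) * \<tau> powr \<epsilon> * D powr (1 + \<epsilon>)"
proof (cases "D = 0")
  case True
  then have "(\<Sum>n\<in>N. h n) = 0" using l1 h by (simp add: antisym sum_nonneg)
  then have "\<forall>n\<in>N. h n = 0" using fin h by (simp add: sum_nonneg_eq_0_iff)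
  then show ?thesis using True by simp
next
  case False
  then have D: "D > 0" using D by simp
  \<comment> \<open>This height balances the two contributions: both become multiples of
    \<open>\<tau> powr \<epsilon> * D powr (1 + \<epsilon>)\<close>. It is positive only for D > 0,
    hence the separate case D = 0.\<close>
  define t where "t = D * \<tau>"
  have t: "t > 0" using D \<tau> by (simp add: t_def)
  have "(\<Sum>n\<in>N. h n powr (1 + \<epsilon>)) \<le> (\<Sum>n\<in>N. t powr \<epsilon> * h n + t powr (\<epsilon> - 1) * (h n)\<^sup>2)"
    using h \<epsilon> t by (intro sum_mono powr_between_le) auto
  also have "\<dots> = t powr \<epsilon> * (\<Sum>n\<in>N. h n) + t powr (\<epsilon> - 1) * (\<Sum>n\<in>N. (h n)\<^sup>2)"
    by (simp add: sum.distrib sum_distrib_left)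
  also have "\<dots> \<le> t powr \<epsilon> * (A * D) + t powr (\<epsilon> - 1) * (c * \<tau> * D\<^sup>2)"
    using l1 l2 by (intro add_mono mult_left_mono) auto
  also have "\<dots> = (A + c) * \<tau> powr \<epsilon> * D powr (1 + \<epsilon>)"
    using D \<tau> by (simp add: t_def powr_mult powr_diff powr_add field_simps power2_eq_square)
  finally show ?thesis .
qed

section \<open>Norm estimates for sums of products of shifts\<close>

text \<open>Square summability is expressed by a bound on all finite partial sums. Injective images
  of finite sets are finite, so such a bound survives translations and reflections.\<close>

lemma sum_le_of_inj_on:
  fixes u :: "'b \<Rightarrow> real"
  assumes "\<And>X. finite X \<Longrightarrow> (\<Sum>x\<in>X. (u x)\<^sup>2) \<le> U" and "finite X" and "inj_on \<phi> X"
  shows "(\<Sum>x\<in>X. (u (\<phi> x))\<^sup>2) \<le> U"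
  using assms(1)[of "\<phi> ` X"] assms(2,3) by (simp add: sum.reindex o_def)

text \<open>For each fixed m, Cauchy-Schwarz in n and translation invariance give
  \<open>sqrt (U * V)\<close>, whatever P and Q are.\<close>

lemma l1_sum_shifts:
  fixes u v :: "'b::ab_group_add \<Rightarrow> real" and P Q :: "'a \<Rightarrow> 'b"
  assumes u: "\<And>X. finite X \<Longrightarrow> (\<Sum>x\<in>X. (u x)\<^sup>2) \<le> U"
    and v: "\<And>X. finite X \<Longrightarrow> (\<Sum>x\<in>X. (v x)\<^sup>2) \<le> V"
    and N: "finite N"
  shows "(\<Sum>n\<in>N. \<Sum>m\<in>A. u (n - P m) * v (n - Q m)) \<le> real (card A) * sqrt (U * V)"
proof -
  have U: "U \<ge> 0" using u[of "{}"] by simp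
  have "(\<Sum>n\<in>N. \<Sum>m\<in>A. u (n - P m) * v (n - Q m)) = (\<Sum>m\<in>A. \<Sum>n\<in>N. u (n - P m) * v (n - Q m))"
    by (rule sum.swap)
  also have "\<dots> \<le> (\<Sum>m\<in>A. sqrt (U * V))"
  proof (rule sum_mono)
    fix m
    have "(\<Sum>n\<in>N. u (n - P m) * v (n - Q m))\<^sup>2
        \<le> (\<Sum>n\<in>N. (u (n - P m))\<^sup>2) * (\<Sum>n\<in>N. (v (n - Q m))\<^sup>2)"
      by (rule Cauchy_Schwarz_ineq_sum)
    also have "\<dots> \<le> U * V"
      using N U
      by (intro mult_mono sum_le_of_inj_on[OF u] sum_le_of_inj_on[OF v])
        (auto simp: inj_on_def intro: sum_nonneg)
    finally show "(\<Sum>n\<in>N. u (n - P m) * v (n - Q m)) \<le> sqrt (U * V)"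
      by (rule real_le_rsqrt)
  qed
  finally show ?thesis by simp
qed

text \<open>Cauchy-Schwarz in m with weight r(m), the size of the fibre of P through m. The factor
  with 1 / r(m) counts each value of P once and is at most U for every n. The other factor, summed
  over n, is at most V times the sum of the r(m), which is the number of coincident pairs. Nothing
  is asked of Q.\<close>

lemma l2_sum_shifts:
  fixes u v :: "'b::ab_group_add \<Rightarrow> real" and P Q :: "'a \<Rightarrow> 'b"
  assumes u: "\<And>X. finite X \<Longrightarrow> (\<Sum>x\<in>X. (u x)\<^sup>2) \<le> U"
    and v: "\<And>X. finite X \<Longrightarrow> (\<Sum>x\<in>X. (v x)\<^sup>2) \<le> V"
    and N: "finite N" and A: "finite A"
  shows "(\<Sum>n\<in>N. (\<Sum>m\<in>A. u (n - P m) * v (n - Q m))\<^sup>2)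
    \<le> real (card {(m, m'). m \<in> A \<and> m' \<in> A \<and> P m = P m'}) * (U * V)"
proof -
  define r where "r m = card {m' \<in> A. P m' = P m}" for m
  have r: "r m > 0" if "m \<in> A" for m
    using that A by (auto simp: r_def card_gt_0_iff)
  have U: "U \<ge> 0" using u[of "{}"] by simp
  have ineq: "(\<Sum>m\<in>A. u (n - P m) * v (n - Q m))\<^sup>2 \<le> U * (\<Sum>m\<in>A. real (r m) * (v (n - Q m))\<^sup>2)" for n
  proof -
    have "(\<Sum>m\<in>A. u (n - P m) * v (n - Q m))
        = (\<Sum>m\<in>A. (u (n - P m) / sqrt (r m)) * (sqrt (r m) * v (n - Q m)))"
      by (intro sum.cong refl) (simp add: r less_imp_neq[OF r, symmetric])
    then have "(\<Sum>m\<in>A. u (n - P m) * v (n - Q m))\<^sup>2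
        \<le> (\<Sum>m\<in>A. (u (n - P m) / sqrt (r m))\<^sup>2) * (\<Sum>m\<in>A. (sqrt (r m) * v (n - Q m))\<^sup>2)"
      by (simp only: Cauchy_Schwarz_ineq_sum)
    also have "\<dots> = (\<Sum>m\<in>A. (u (n - P m))\<^sup>2 / real (r m)) * (\<Sum>m\<in>A. real (r m) * (v (n - Q m))\<^sup>2)"
      by (simp add: power_divide power_mult_distrib)
    also have "(\<Sum>m\<in>A. (u (n - P m))\<^sup>2 / real (r m)) \<le> U"
    proof -
      have "(\<Sum>m\<in>A. (u (n - P m))\<^sup>2 / real (r m))
          = (\<Sum>l\<in>P ` A. \<Sum>m\<in>{m \<in> A. P m = l}. (u (n - P m))\<^sup>2 / real (r m))"
        by (rule sum.image_gen[OF A])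
      \<comment> \<open>On the fibre over l the summand is constant and the divisor is the size of
        the fibre, so the fibre contributes exactly one copy.\<close>
      also have "\<dots> = (\<Sum>l\<in>P ` A. (u (n - l))\<^sup>2)"
      proof (rule sum.cong)
        fix l assume "l \<in> P ` A"
        then have "card {m \<in> A. P m = l} > 0" using A by (auto simp: card_gt_0_iff)
        moreover have "(\<Sum>m\<in>{m \<in> A. P m = l}. (u (n - P m))\<^sup>2 / real (r m))
            = (\<Sum>m\<in>{m \<in> A. P m = l}. (u (n - l))\<^sup>2 / real (card {m \<in> A. P m = l}))"
          by (rule sum.cong) (auto simp: r_def)
        ultimately show "(\<Sum>m\<in>{m \<in> A. P m = l}. (u (n - P m))\<^sup>2 / real (r m)) = (u (n - l))\<^sup>2"
          by simp
      qed simp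
      also have "\<dots> \<le> U"
        by (rule sum_le_of_inj_on[OF u]) (use A in \<open>auto simp: inj_on_def\<close>)
      finally show ?thesis .
    qed
    finally show ?thesis by (simp add: mult_right_mono sum_nonneg)
  qed
  have "(\<Sum>n\<in>N. (\<Sum>m\<in>A. u (n - P m) * v (n - Q m))\<^sup>2)
      \<le> (\<Sum>n\<in>N. U * (\<Sum>m\<in>A. real (r m) * (v (n - Q m))\<^sup>2))"
    by (intro sum_mono ineq)
  also have "\<dots> = U * (\<Sum>m\<in>A. real (r m) * (\<Sum>n\<in>N. (v (n - Q m))\<^sup>2))"
    by (simp only: sum_distrib_left sum.swap[of _ N A])
  also have "\<dots> \<le> U * (\<Sum>m\<in>A. real (r m) * V)"
    using U N
    by (intro mult_left_mono sum_mono sum_le_of_inj_on[OF v]) (auto simp: inj_on_def)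
  also have "\<dots> = real (\<Sum>m\<in>A. r m) * (U * V)"
    by (simp add: sum_distrib_right[symmetric])
  also have "(\<Sum>m\<in>A. r m) = card (SIGMA m:A. {m' \<in> A. P m' = P m})"
    using A by (simp add: r_def)
  also have "(SIGMA m:A. {m' \<in> A. P m' = P m}) = {(m, m'). m \<in> A \<and> m' \<in> A \<and> P m = P m'}"
    by auto
  finally show ?thesis .
qed

section \<open>Dyadic decomposition of the nonzero integers\<close>

definition dyadic_block :: "nat \<Rightarrow> int set" where
  "dyadic_block k = {2 ^ k..<2 ^ (k + 1)} \<union> {- (2 ^ (k + 1))<..- (2 ^ k)}"

lemma finite_dyadic_block [simp]: "finite (dyadic_block k)"
  by (simp add: dyadic_block_def)

lemma card_dyadic_block_le: "card (dyadic_block k) \<le> 2 * 2 ^ k"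
proof -
  have "card {2 ^ k..<2 ^ (k + 1) :: int} = 2 ^ k" "card {- (2 ^ (k + 1))<..- (2 ^ k) :: int} = 2 ^ k"
    by (simp_all add: nat_power_eq)
  then show ?thesis
    unfolding dyadic_block_def by (metis card_Un_le mult_2)
qed

lemma mem_dyadic_block: "m \<in> dyadic_block k \<longleftrightarrow> 2 ^ k \<le> \<bar>m\<bar> \<and> \<bar>m\<bar> < 2 ^ (k + 1)"
proof -
  have "(0::int) < 2 ^ k" "(0::int) < 2 ^ (k + 1)" by simp_all
  then show ?thesis
    unfolding dyadic_block_def Un_iff atLeastLessThan_iff greaterThanAtMost_iff by linarith
qed

lemma disjoint_dyadic_blocks: "j \<noteq> k \<Longrightarrow> dyadic_block j \<inter> dyadic_block k = {}"
proof (induction j k rule: linorder_wlog)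
  case (le j k)
  then have "(2::int) ^ (j + 1) \<le> 2 ^ k" by (intro power_increasing) auto
  then show ?case by (auto simp: mem_dyadic_block)
qed auto

lemma ex_dyadic_block:
  assumes "m \<noteq> 0" shows "\<exists>k. m \<in> dyadic_block k"
proof -
  have "1 \<le> nat \<bar>m\<bar>" using assms by simp
  then obtain k where "2 ^ k \<le> nat \<bar>m\<bar>" "nat \<bar>m\<bar> < 2 ^ (k + 1)"
    using ex_power_ivl1[of 2 "nat \<bar>m\<bar>"] by auto
  then have "2 ^ k \<le> \<bar>m\<bar>" "\<bar>m\<bar> < 2 ^ (k + 1)"
    by (simp_all add: le_nat_iff nat_less_iff)
  then show ?thesis by (auto simp: mem_dyadic_block)
qed

lemma finite_subset_dyadic_blocks:
  assumes "finite M" "M \<subseteq> UNIV - {0}"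
  shows "\<exists>K. M \<subseteq> (\<Union>k<K. dyadic_block k)"
  using assms
proof (induction M)
  case (insert m M)
  then obtain K k where "M \<subseteq> (\<Union>k<K. dyadic_block k)" "m \<in> dyadic_block k"
    using ex_dyadic_block[of m] by auto
  then have "insert m M \<subseteq> (\<Union>k<max K (Suc k). dyadic_block k)"
    by (fastforce simp: less_max_iff_disj)
  then show ?case by blast
qed simp

text \<open>The division by \<open>(2 ^ k)\<^sup>2\<close> anticipates the squared kernel, of size
  at most \<open>1 / 2 ^ k\<close> on the block.\<close>

lemma card_coincidences_dyadic_block:
  assumes "condition_star_star \<delta> \<delta>' P"
  shows "real (card {(m, m'). m \<in> dyadic_block k \<and> m' \<in> dyadic_block k \<and> P m = P m'}) / (2 ^ k)\<^sup>2
    \<le> 4 * \<delta>' / (ln 2) powr (2 + 2 * \<delta>) * real (Suc k) powr - (2 + 2 * \<delta>)"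
proof -
  \<comment> \<open>Taking the upper end of the block as the scale ensures M \<ge> 2 even for k = 0,
    and the block still lies between M / 2 and 2 * M. The factor 4 in the bound is the square of
    \<open>M / 2 ^ k\<close>.\<close>
  define M :: real where "M = 2 ^ Suc k"
  have M: "M \<ge> 2" by (simp add: M_def)
  have blk: "M / 2 \<le> real_of_int \<bar>m\<bar> \<and> real_of_int \<bar>m\<bar> \<le> 2 * M" if "m \<in> dyadic_block k" for m
  proof -
    have "2 ^ k \<le> \<bar>m\<bar>" "\<bar>m\<bar> < 2 ^ (k + 1)" using that by (auto simp: mem_dyadic_block)
    then have "real_of_int (2 ^ k) \<le> real_of_int \<bar>m\<bar>" "real_of_int \<bar>m\<bar> < real_of_int (2 ^ (k + 1))"
      by (simp_all only: of_int_le_iff of_int_less_iff)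
    then show ?thesis by (simp add: M_def)
  qed
  have "{(m, m'). m \<in> dyadic_block k \<and> m' \<in> dyadic_block k \<and> P m = P m'} \<subseteq> coincidence_set P M M"
    using blk by (auto simp: coincidence_set_def)
  then have "real (card {(m, m'). m \<in> dyadic_block k \<and> m' \<in> dyadic_block k \<and> P m = P m'})
      \<le> real (card (coincidence_set P M M))"
    by (simp add: card_mono finite_coincidence_set)
  also have "\<dots> \<le> \<delta>' * M * M / (ln M * ln M) powr (1 + \<delta>)"
    using assms M by (auto simp: condition_star_star_def)
  also have "(ln M * ln M) powr (1 + \<delta>) = (ln 2) powr (2 + 2 * \<delta>) * real (Suc k) powr (2 + 2 * \<delta>)"
  proof -
    have "ln M = real (Suc k) * ln 2" unfolding M_def by (simp only: ln_realpow)
    then have "(ln M * ln M) powr (1 + \<delta>) = ((ln 2 * real (Suc k)) powr 2) powr (1 + \<delta>)"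
      by (simp add: power2_eq_square mult_ac)
    also have "\<dots> = (ln 2 * real (Suc k)) powr (2 + 2 * \<delta>)"
      by (simp only: powr_powr) (simp add: algebra_simps)
    finally show ?thesis by (simp only: powr_mult)
  qed
  finally have "real (card {(m, m'). m \<in> dyadic_block k \<and> m' \<in> dyadic_block k \<and> P m = P m'}) / (2 ^ k)\<^sup>2
      \<le> \<delta>' * M * M / ((ln 2) powr (2 + 2 * \<delta>) * real (Suc k) powr (2 + 2 * \<delta>)) / (2 ^ k)\<^sup>2"
    by (rule divide_right_mono) simp
  also have "\<dots> = 4 * \<delta>' / (ln 2) powr (2 + 2 * \<delta>) * real (Suc k) powr - (2 + 2 * \<delta>)"
    unfolding powr_minus_divide by (simp add: M_def power2_eq_square)
  finally show ?thesis .
qed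

section \<open>Estimates on single blocks and their summation\<close>

text \<open>Here u and v will be the moduli of f and g. The kernel is taken in absolute value, so no
  cancellation between m and -m is exploited.\<close>

definition B_block where
  "B_block P Q u v n k = (\<Sum>m\<in>dyadic_block k. u (n - P m) * v (n - Q m) / real_of_int \<bar>m\<bar>)"

lemma B_block_nonneg:
  assumes "\<And>x. u x \<ge> 0" "\<And>x. v x \<ge> 0"
  shows "B_block P Q u v n k \<ge> 0"
  unfolding B_block_def using assms by (intro sum_nonneg) auto

lemma B_block_le:
  assumes "\<And>x. u x \<ge> 0" "\<And>x. v x \<ge> 0"
  shows "B_block P Q u v n k \<le> (\<Sum>m\<in>dyadic_block k. u (n - P m) * v (n - Q m)) / 2 ^ k"
  unfolding B_block_def sum_divide_distrib
proof (rule sum_mono)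
  fix m assume "m \<in> dyadic_block k"
  then have "real_of_int (2 ^ k) \<le> real_of_int \<bar>m\<bar>"
    by (simp only: mem_dyadic_block of_int_le_iff)
  then have le: "2 ^ k \<le> real_of_int \<bar>m\<bar>" by simp
  have "0 < real_of_int \<bar>m\<bar>" by (rule less_le_trans[OF _ le]) simp
  then show "u (n - P m) * v (n - Q m) / real_of_int \<bar>m\<bar> \<le> u (n - P m) * v (n - Q m) / 2 ^ k"
    using assms le by (intro divide_left_mono mult_pos_pos) auto
qed

text \<open>Interpolation with \<open>D = sqrt (U * V)\<close> and \<tau> the power of k + 1
  supplied by the coincidence count. The l^1 constant 2 is the bound \<open>2 * 2 ^ k\<close> for
  the size of the block times the kernel bound \<open>1 / 2 ^ k\<close>.\<close>

lemma B_block_powr_sum: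
  assumes P: "condition_star_star \<delta> \<delta>' P" and \<epsilon>: "0 < \<epsilon>" "\<epsilon> < 1"
    and u: "\<And>X. finite X \<Longrightarrow> (\<Sum>x\<in>X. (u x)\<^sup>2) \<le> U" "\<And>x. u x \<ge> 0"
    and v: "\<And>X. finite X \<Longrightarrow> (\<Sum>x\<in>X. (v x)\<^sup>2) \<le> V" "\<And>x. v x \<ge> 0"
    and N: "finite N"
  shows "(\<Sum>n\<in>N. B_block P Q u v n k powr (1 + \<epsilon>))
    \<le> (2 + 4 * \<delta>' / (ln 2) powr (2 + 2 * \<delta>)) * (real (Suc k) powr - (2 + 2 * \<delta>)) powr \<epsilon>
      * sqrt (U * V) powr (1 + \<epsilon>)"
proof (rule sum_powr_interpolation[OF N _ \<epsilon>])
  define s where "s n = (\<Sum>m\<in>dyadic_block k. u (n - P m) * v (n - Q m))" for n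
  have UV: "U \<ge> 0" "V \<ge> 0" using u(1)[of "{}"] v(1)[of "{}"] by simp_all
  have le: "B_block P Q u v n k \<le> s n / 2 ^ k" for n
    unfolding s_def by (rule B_block_le[OF u(2) v(2)])
  show "sqrt (U * V) \<ge> 0" using UV by simp
  show "B_block P Q u v n k \<ge> 0" for n by (rule B_block_nonneg[OF u(2) v(2)])
  have "(\<Sum>n\<in>N. B_block P Q u v n k) \<le> (\<Sum>n\<in>N. s n / 2 ^ k)"
    by (intro sum_mono le)
  also have "\<dots> = (\<Sum>n\<in>N. s n) / 2 ^ k" by (simp add: sum_divide_distrib)
  also have "\<dots> \<le> real (card (dyadic_block k)) * sqrt (U * V) / 2 ^ k"
    unfolding s_def by (intro divide_right_mono l1_sum_shifts u v N) auto
  also have "\<dots> \<le> real (2 * 2 ^ k) * sqrt (U * V) / 2 ^ k"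
    using UV card_dyadic_block_le[of k]
    by (intro divide_right_mono mult_right_mono) (simp_all only: of_nat_le_iff, simp_all)
  finally show "(\<Sum>n\<in>N. B_block P Q u v n k) \<le> 2 * sqrt (U * V)" by simp
  have "(\<Sum>n\<in>N. (B_block P Q u v n k)\<^sup>2) \<le> (\<Sum>n\<in>N. (s n / 2 ^ k)\<^sup>2)"
    by (intro sum_mono power_mono le B_block_nonneg u v)
  also have "\<dots> = (\<Sum>n\<in>N. (s n)\<^sup>2) / (2 ^ k)\<^sup>2"
    by (simp add: sum_divide_distrib power_divide)
  also have "\<dots> \<le> real (card {(m, m'). m \<in> dyadic_block k \<and> m' \<in> dyadic_block k \<and> P m = P m'})
      * (U * V) / (2 ^ k)\<^sup>2"
    unfolding s_def by (intro divide_right_mono l2_sum_shifts u v N) auto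
  also have "\<dots> = real (card {(m, m'). m \<in> dyadic_block k \<and> m' \<in> dyadic_block k \<and> P m = P m'})
      / (2 ^ k)\<^sup>2 * (U * V)" by simp
  also have "\<dots> \<le> 4 * \<delta>' / (ln 2) powr (2 + 2 * \<delta>) * real (Suc k) powr - (2 + 2 * \<delta>) * (U * V)"
    using UV by (intro mult_right_mono card_coincidences_dyadic_block[OF P]) auto
  finally show "(\<Sum>n\<in>N. (B_block P Q u v n k)\<^sup>2)
      \<le> 4 * \<delta>' / (ln 2) powr (2 + 2 * \<delta>) * real (Suc k) powr - (2 + 2 * \<delta>) * (sqrt (U * V))\<^sup>2"
    using UV by simp
qed simp

text \<open>H is chosen before all functions and finite ranges; this uniformity later permits the
  limits in n and m.\<close>

lemma B_block_sum_bound: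
  fixes \<delta> \<delta>' \<epsilon> :: real
  assumes "\<delta> > 0" and "\<delta>' > 0" and "\<epsilon> \<in> {1 / (2 * \<delta> + 1)<..<1}"
  shows "\<exists>H\<ge>0. \<forall>P Q u v (U :: real) (V :: real) N K. condition_star_star \<delta> \<delta>' P \<longrightarrow>
    (\<forall>X. finite X \<longrightarrow> (\<Sum>x\<in>X. (u x)\<^sup>2) \<le> U) \<longrightarrow> (\<forall>x. u x \<ge> 0) \<longrightarrow>
    (\<forall>X. finite X \<longrightarrow> (\<Sum>x\<in>X. (v x)\<^sup>2) \<le> V) \<longrightarrow> (\<forall>x. v x \<ge> 0) \<longrightarrow> finite N \<longrightarrow>
    (\<Sum>n\<in>N. (\<Sum>k<K. B_block P Q u v n k) powr (1 + \<epsilon>)) \<le> H * sqrt (U * V) powr (1 + \<epsilon>)"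
proof -
  have \<epsilon>: "0 < \<epsilon>" "\<epsilon> < 1" "1 < \<epsilon> * (2 * \<delta> + 1)"
  proof -
    have "0 < 1 / (2 * \<delta> + 1)" "1 / (2 * \<delta> + 1) < \<epsilon>" using assms by auto
    then show "0 < \<epsilon>" by linarith
    show "1 < \<epsilon> * (2 * \<delta> + 1)"
      using \<open>1 / (2 * \<delta> + 1) < \<epsilon>\<close> \<open>\<delta> > 0\<close> by (simp add: divide_less_eq)
  qed (use assms in auto)
  \<comment> \<open>The lower bound on \<epsilon> says that
    \<open>\<epsilon> * (2 * \<delta> + 1)\<close> exceeds 1. Half of this excess goes to \<eta>,
    which makes the weights w summable; the other half keeps the final exponent
    \<open>e = \<epsilon> * \<eta> - \<epsilon> * (2 * \<delta> + 1)\<close> below -1.\<close>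
  define \<eta> where "\<eta> = (\<epsilon> * (2 * \<delta> + 1) - 1) / (2 * \<epsilon>)"
  have \<eta>: "\<eta> > 0" "\<epsilon> * \<eta> < \<epsilon> * (2 * \<delta> + 1) - 1"
    using \<epsilon> by (auto simp: \<eta>_def)
  define w where "w k = real (Suc k) powr - (1 + \<eta>)" for k
  define e where "e = \<epsilon> * (1 + \<eta>) - \<epsilon> * (2 + 2 * \<delta>)"
  have e: "e < -1" using \<eta> by (simp add: e_def algebra_simps)
  have summable_Suc: "summable (\<lambda>k. real (Suc k) powr a)" if "a < -1" for a
    using that summable_real_powr_iff[of a] summable_Suc_iff[of "\<lambda>n. real n powr a"] by blast
  define W where "W = (\<Sum>k. w k)"
  define Z where "Z = (\<Sum>k. real (Suc k) powr e)"
  define c where "c = 2 + 4 * \<delta>' / (ln 2) powr (2 + 2 * \<delta>)"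
  have W: "(\<Sum>k<K. w k) \<le> W" for K
    unfolding W_def w_def using \<eta> by (intro sum_le_suminf summable_Suc) auto
  have Z: "(\<Sum>k<K. real (Suc k) powr e) \<le> Z" for K
    unfolding Z_def using e by (intro sum_le_suminf summable_Suc) auto
  have Z0: "Z \<ge> 0" using Z[of 0] by simp
  have c0: "c \<ge> 0" using assms by (simp add: c_def)
  have wk: "w k > 0" for k by (simp add: w_def)
  show ?thesis
  proof (intro exI[of _ "W powr \<epsilon> * (c * Z)"] conjI allI impI)
    show "W powr \<epsilon> * (c * Z) \<ge> 0" using Z0 c0 by simp
    fix P Q :: "int \<Rightarrow> int" and u v :: "int \<Rightarrow> real" and U V :: real and K and N :: "int set"
    assume P: "condition_star_star \<delta> \<delta>' P"
      and "\<forall>X. finite X \<longrightarrow> (\<Sum>x\<in>X. (u x)\<^sup>2) \<le> U" "\<forall>x. u x \<ge> 0"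
      and "\<forall>X. finite X \<longrightarrow> (\<Sum>x\<in>X. (v x)\<^sup>2) \<le> V" "\<forall>x. v x \<ge> 0" and N: "finite N"
    then have u: "\<And>X. finite X \<Longrightarrow> (\<Sum>x\<in>X. (u x)\<^sup>2) \<le> U" "\<And>x. u x \<ge> 0"
      and v: "\<And>X. finite X \<Longrightarrow> (\<Sum>x\<in>X. (v x)\<^sup>2) \<le> V" "\<And>x. v x \<ge> 0" by blast+
    define D where "D = sqrt (U * V) powr (1 + \<epsilon>)"
    have D0: "D \<ge> 0" by (simp add: D_def)
    \<comment> \<open>The weighted Jensen inequality is used in k at each n; exchanging the sums
      then leaves the single-block estimates.\<close>
    have "(\<Sum>n\<in>N. (\<Sum>k<K. B_block P Q u v n k) powr (1 + \<epsilon>))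
        \<le> (\<Sum>n\<in>N. (\<Sum>k<K. w k) powr \<epsilon> * (\<Sum>k<K. w k powr - \<epsilon> * B_block P Q u v n k powr (1 + \<epsilon>)))"
    proof (rule sum_mono)
      fix n
      show "(\<Sum>k<K. B_block P Q u v n k) powr (1 + \<epsilon>)
        \<le> (\<Sum>k<K. w k) powr \<epsilon> * (\<Sum>k<K. w k powr - \<epsilon> * B_block P Q u v n k powr (1 + \<epsilon>))"
        using powr_sum_le_weighted[of "{..<K}" "1 + \<epsilon>" w "B_block P Q u v n"] \<epsilon> wk
        by (simp add: B_block_nonneg u v)
    qed
    also have "\<dots> = (\<Sum>k<K. w k) powr \<epsilon>
        * (\<Sum>k<K. w k powr - \<epsilon> * (\<Sum>n\<in>N. B_block P Q u v n k powr (1 + \<epsilon>)))"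
      by (simp only: sum_distrib_left sum.swap[of _ N "{..<K}"])
    also have "\<dots> \<le> W powr \<epsilon> * (\<Sum>k<K. w k powr - \<epsilon> * (c * (real (Suc k) powr - (2 + 2 * \<delta>)) powr \<epsilon> * D))"
      unfolding c_def D_def using wk \<epsilon>
      by (intro mult_mono powr_mono2 sum_mono mult_left_mono W B_block_powr_sum[OF P] u v N)
        (auto intro!: sum_nonneg mult_nonneg_nonneg less_imp_le[OF wk])
    also have "\<dots> = W powr \<epsilon> * (\<Sum>k<K. c * D * real (Suc k) powr e)"
    proof -
      have "w k powr - \<epsilon> * (real (Suc k) powr - (2 + 2 * \<delta>)) powr \<epsilon> = real (Suc k) powr e" for k
        unfolding w_def e_def powr_powr powr_add[symmetric] by (simp add: algebra_simps)
      then have "w k powr - \<epsilon> * (c * (real (Suc k) powr - (2 + 2 * \<delta>)) powr \<epsilon> * D)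
          = c * D * real (Suc k) powr e" for k
        by (metis (no_types, opaque_lifting) mult.assoc mult.commute)
      then show ?thesis by (simp only:)
    qed
    also have "\<dots> = W powr \<epsilon> * (c * D * (\<Sum>k<K. real (Suc k) powr e))"
      by (simp add: sum_distrib_left)
    also have "\<dots> \<le> W powr \<epsilon> * (c * D * Z)"
      using c0 D0 by (intro mult_left_mono Z) auto
    finally show "(\<Sum>n\<in>N. (\<Sum>k<K. B_block P Q u v n k) powr (1 + \<epsilon>))
        \<le> W powr \<epsilon> * (c * Z) * sqrt (U * V) powr (1 + \<epsilon>)"
      by (simp add: D_def mult_ac)
  qed
qed

section \<open>Passage from finite sums to the operator\<close>

lemma sum_norm_B_dis_term_le:
  assumes "finite M" "M \<subseteq> (\<Union>k<K. dyadic_block k)"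
  shows "(\<Sum>m\<in>M. norm (B_dis_term P Q f g n m))
    \<le> (\<Sum>k<K. B_block P Q (\<lambda>x. norm (f x)) (\<lambda>x. norm (g x)) n k)"
proof -
  have "(\<Sum>m\<in>M. norm (B_dis_term P Q f g n m))
      \<le> (\<Sum>m\<in>(\<Union>k<K. dyadic_block k). norm (B_dis_term P Q f g n m))"
    using assms by (intro sum_mono2) auto
  also have "\<dots> = (\<Sum>k<K. \<Sum>m\<in>dyadic_block k. norm (B_dis_term P Q f g n m))"
    by (rule sum.UNION_disjoint) (auto dest: disjoint_dyadic_blocks)
  also have "\<dots> = (\<Sum>k<K. B_block P Q (\<lambda>x. norm (f x)) (\<lambda>x. norm (g x)) n k)"
    unfolding B_block_def B_dis_term_def by (simp add: norm_mult norm_divide)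
  finally show ?thesis .
qed

lemma lp_space_2_sum_le:
  assumes "f \<in> lp_space 2" "finite X"
  shows "(\<Sum>x\<in>X. (norm (f x))\<^sup>2) \<le> (lp_norm 2 f)\<^sup>2"
proof -
  have s: "(\<lambda>n. (norm (f n))\<^sup>2) summable_on UNIV" using assms by (simp add: lp_space_def)
  have "(lp_norm 2 f)\<^sup>2 = (\<Sum>\<^sub>\<infinity>n. (norm (f n))\<^sup>2)"
    by (simp add: lp_norm_def powr_half_sqrt infsum_nonneg)
  moreover have "(\<Sum>x\<in>X. (norm (f x))\<^sup>2) \<le> (\<Sum>\<^sub>\<infinity>n. (norm (f n))\<^sup>2)"
    by (rule finite_sum_le_infsum) (use s assms in auto)
  ultimately show ?thesis by simp
qed

lemma lp_norm_leI:
  assumes "p > 0" "C \<ge> 0"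
    and bound: "\<And>N. finite N \<Longrightarrow> (\<Sum>n\<in>N. norm (h n) powr p) \<le> C powr p"
  shows "h \<in> lp_space p" "lp_norm p h \<le> C"
proof -
  \<comment> \<open>Summability comes first, since \<open>infsum\<close> would otherwise take its
    default value 0.\<close>
  have s: "(\<lambda>n. norm (h n) powr p) summable_on UNIV"
    using bound by (intro nonneg_bdd_above_summable_on) (auto intro!: bdd_aboveI)
  then show "h \<in> lp_space p" by (simp add: lp_space_def)
  have "(\<Sum>\<^sub>\<infinity>n. norm (h n) powr p) \<le> C powr p"
    by (rule infsum_le_finite_sums[OF s bound])
  then have "lp_norm p h \<le> (C powr p) powr (1 / p)"
    unfolding lp_norm_def using assms by (intro powr_mono2) (auto simp: infsum_nonneg)
  then show "lp_norm p h \<le> C" using assms by (simp add: powr_powr)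
qed

text \<open>A Fatou-type argument: the uniform bound first gives absolute convergence in m at each
  n, then survives the limit over finite sets of m.\<close>

lemma B_dis_bounded:
  fixes f g :: "int \<Rightarrow> complex"
  assumes p: "p > 0" and C: "C \<ge> 0"
    and bound: "\<And>N K. finite N \<Longrightarrow>
      (\<Sum>n\<in>N. (\<Sum>k<K. B_block P Q (\<lambda>x. norm (f x)) (\<lambda>x. norm (g x)) n k) powr p) \<le> C powr p"
  shows "B_dis_term P Q f g n summable_on (UNIV - {0})"
    and "B_dis P Q f g \<in> lp_space p" and "lp_norm p (B_dis P Q f g) \<le> C"
proof -
  define b where "b n K = (\<Sum>k<K. B_block P Q (\<lambda>x. norm (f x)) (\<lambda>x. norm (g x)) n k)" for n K
  have b0: "b n K \<ge> 0" for n K unfolding b_def by (intro sum_nonneg B_block_nonneg) auto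
  have bC: "b n K \<le> C" for n K
  proof -
    \<comment> \<open>A single n suffices for a pointwise bound uniform in K.\<close>
    have "b n K powr p \<le> C powr p" using bound[of "{n}" K] by (simp add: b_def)
    then show ?thesis using p C b0[of n K] powr_less_mono2[of p C "b n K"] by linarith
  qed
  \<comment> \<open>K depends on M alone, so one K serves all n of a finite set N at once.\<close>
  have fin: "\<exists>K. \<forall>n. (\<Sum>m\<in>M. norm (B_dis_term P Q f g n m)) \<le> b n K"
    if "finite M" "M \<subseteq> UNIV - {0}" for M
    using finite_subset_dyadic_blocks[OF that] sum_norm_B_dis_term_le[OF that(1)]
    unfolding b_def by blast
  have summable: "B_dis_term P Q f g n summable_on (UNIV - {0})" for n
  proof (rule abs_summable_summable, rule nonneg_bdd_above_summable_on)
    have "(\<Sum>m\<in>M. norm (B_dis_term P Q f g n m)) \<le> C" if M: "finite M" "M \<subseteq> UNIV - {0}" for M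
      using fin[OF M] bC order_trans by meson
    then show "bdd_above (sum (\<lambda>x. norm (B_dis_term P Q f g n x)) ` {F. F \<subseteq> UNIV - {0} \<and> finite F})"
      by (intro bdd_aboveI[of _ C]) auto
  qed simp
  then show "B_dis_term P Q f g n summable_on (UNIV - {0})" .
  have "(\<Sum>n\<in>N. norm (B_dis P Q f g n) powr p) \<le> C powr p" if N: "finite N" for N
  proof (rule tendsto_upperbound)
    \<comment> \<open>The norms may tend to 0; the power is still continuous there, since p > 0 and
      norms are nonnegative.\<close>
    show "((\<lambda>M. \<Sum>n\<in>N. norm (\<Sum>m\<in>M. B_dis_term P Q f g n m) powr p)
        \<longlongrightarrow> (\<Sum>n\<in>N. norm (B_dis P Q f g n) powr p)) (finite_subsets_at_top (UNIV - {0}))"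
      unfolding B_dis_def using p
      by (intro tendsto_sum tendsto_powr2 tendsto_norm tendsto_const infsum_tendsto summable) auto
    show "\<forall>\<^sub>F M in finite_subsets_at_top (UNIV - {0}).
        (\<Sum>n\<in>N. norm (\<Sum>m\<in>M. B_dis_term P Q f g n m) powr p) \<le> C powr p"
    proof (rule eventually_finite_subsets_at_top_weakI)
      fix M :: "int set" assume M: "finite M" "M \<subseteq> UNIV - {0}"
      obtain K where K: "\<And>n. (\<Sum>m\<in>M. norm (B_dis_term P Q f g n m)) \<le> b n K"
        using fin[OF M] by blast
      have "(\<Sum>n\<in>N. norm (\<Sum>m\<in>M. B_dis_term P Q f g n m) powr p) \<le> (\<Sum>n\<in>N. b n K powr p)"
        using p K by (intro sum_mono powr_mono2) (auto intro: order_trans[OF norm_sum])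
      also have "\<dots> \<le> C powr p" using bound[OF N, of K] by (simp add: b_def)
      finally show "(\<Sum>n\<in>N. norm (\<Sum>m\<in>M. B_dis_term P Q f g n m) powr p) \<le> C powr p" .
    qed
  qed simp
  then show "B_dis P Q f g \<in> lp_space p" "lp_norm p (B_dis P Q f g) \<le> C"
    using lp_norm_leI[OF p C] by blast+
qed

section \<open>Symmetry and conclusion\<close>

text \<open>This symmetry reduces the case of a condition on Q to that of a condition on P.\<close>

lemma B_dis_term_commute: "B_dis_term P Q f g = B_dis_term Q P g f"
  by (simp add: B_dis_term_def fun_eq_iff)

lemma B_dis_commute: "B_dis P Q f g = B_dis Q P g f"
  by (simp add: B_dis_def fun_eq_iff B_dis_term_commute[of P])

text \<open>Summability in m and membership in l^(1+\<epsilon>) belong to the conclusion because of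
  the default value of \<open>infsum\<close>: without them the norm inequality could hold
  vacuously.\<close>

theorem theorem1p4:
  fixes \<delta> \<delta>' \<epsilon> :: real
  assumes "\<delta> > 0" and "\<delta>' > 0" and "\<epsilon> \<in> {1 / (2 * \<delta> + 1)<..<1}"
  shows "\<exists>C :: real. \<forall>P Q :: int \<Rightarrow> int.
    condition_star_star \<delta> \<delta>' P \<or> condition_star_star \<delta> \<delta>' Q \<longrightarrow>
    (\<forall>f \<in> lp_space 2. \<forall>g \<in> lp_space 2.
      (\<forall>n. B_dis_term P Q f g n summable_on (UNIV - {0})) \<and>
      B_dis P Q f g \<in> lp_space (1 + \<epsilon>) \<and>
      lp_norm (1 + \<epsilon>) (B_dis P Q f g) \<le> C * lp_norm 2 f * lp_norm 2 g)"
proof -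
  have "0 < 1 / (2 * \<delta> + 1)" "1 / (2 * \<delta> + 1) < \<epsilon>" using assms by auto
  then have p: "1 + \<epsilon> > 0" by linarith
  obtain H where H0: "H \<ge> 0" and H: "\<And>P Q u v (U :: real) (V :: real) N K. condition_star_star \<delta> \<delta>' P \<Longrightarrow>
    (\<And>X. finite X \<Longrightarrow> (\<Sum>x\<in>X. (u x)\<^sup>2) \<le> U) \<Longrightarrow> (\<And>x. u x \<ge> 0) \<Longrightarrow>
    (\<And>X. finite X \<Longrightarrow> (\<Sum>x\<in>X. (v x)\<^sup>2) \<le> V) \<Longrightarrow> (\<And>x. v x \<ge> 0) \<Longrightarrow> finite N \<Longrightarrow>
    (\<Sum>n\<in>N. (\<Sum>k<K. B_block P Q u v n k) powr (1 + \<epsilon>)) \<le> H * sqrt (U * V) powr (1 + \<epsilon>)"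
    using B_block_sum_bound[OF assms] by metis
  \<comment> \<open>Then \<open>C powr (1 + \<epsilon>)\<close> equals H, and C is fixed before P,
    Q, f and g.\<close>
  define C where "C = H powr (1 / (1 + \<epsilon>))"
  have main: "(\<forall>n. B_dis_term P Q f g n summable_on (UNIV - {0})) \<and>
      B_dis P Q f g \<in> lp_space (1 + \<epsilon>) \<and>
      lp_norm (1 + \<epsilon>) (B_dis P Q f g) \<le> C * lp_norm 2 f * lp_norm 2 g"
    if P: "condition_star_star \<delta> \<delta>' P" and f: "f \<in> lp_space 2" and g: "g \<in> lp_space 2" for P Q f g
  proof -
    have nn: "lp_norm 2 f \<ge> 0" "lp_norm 2 g \<ge> 0" "C \<ge> 0" by (simp_all add: lp_norm_def C_def)
    have C: "(C * lp_norm 2 f * lp_norm 2 g) powr (1 + \<epsilon>)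
        = H * sqrt ((lp_norm 2 f)\<^sup>2 * (lp_norm 2 g)\<^sup>2) powr (1 + \<epsilon>)"
      using nn p H0 by (simp add: real_sqrt_mult powr_mult C_def powr_powr)
    have "(\<Sum>n\<in>N. (\<Sum>k<K. B_block P Q (\<lambda>x. norm (f x)) (\<lambda>x. norm (g x)) n k) powr (1 + \<epsilon>))
        \<le> (C * lp_norm 2 f * lp_norm 2 g) powr (1 + \<epsilon>)" if "finite N" for N K
      unfolding C using that by (intro H P lp_space_2_sum_le f g) auto
    then show ?thesis
      using B_dis_bounded[OF p, of "C * lp_norm 2 f * lp_norm 2 g" P Q f g] nn by auto
  qed
  show ?thesis
  proof (intro exI[of _ C] allI impI ballI)
    fix P Q :: "int \<Rightarrow> int" and f g
    assume "condition_star_star \<delta> \<delta>' P \<or> condition_star_star \<delta> \<delta>' Q"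
      and f: "f \<in> lp_space 2" and g: "g \<in> lp_space 2"
    then show "(\<forall>n. B_dis_term P Q f g n summable_on (UNIV - {0})) \<and>
      B_dis P Q f g \<in> lp_space (1 + \<epsilon>) \<and>
      lp_norm (1 + \<epsilon>) (B_dis P Q f g) \<le> C * lp_norm 2 f * lp_norm 2 g"
      using main[of P f g Q] main[of Q g f P] B_dis_term_commute[of P Q f g] B_dis_commute[of P Q f g]
      by (auto simp: mult_ac)
  qed
qed

end
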